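(* Let $\Sigma\subset\mathbb{R}^3$ be an immersed rotationally symmetric self-shrinking torus. Let $F(\Sigma)$ be the entropy of $\Sigma$, and let $r$ be the distance to the axis of rotation. Then $$F(\Sigma)\ge\pi\sqrt2\,\min_\Sigma re^{-|x|^2/4}.$$ Moreover, if $re^{-|x|^2/4}$ is not constant on $\Sigma$, then the inequality is strict, that is, $F(\Sigma)>\pi\sqrt2\,\min_\Sigma re^{-|x|^2/4}$.
   Context: $x$ is the position vector in $\mathbb{R}^3$, with cylindrical coordinates $(r,\theta,z)$ and $|x|^2=r^2+z^2$. For an immersed oriented surface with unit normal $\mathbf{n}$, the second fundamental form is $A(v,w)=\langle\nabla_vw,\mathbf{n}\rangle$ and the mean curvature is $H_\Sigma=-\operatorname{tr}A$. A surface $\Sigma$ is a self-shrinker if $\sqrt{-t}\,\Sigma$, $t<0$, evolves by mean curvature flow $\dot x=-H_\Sigma\mathbf{n}$; equivalently $H_\Sigma=\frac12\langle x,\mathbf{n}\rangle$. A rotationally symmetric torus is generated by rotating, about the axis $\{r=0\}$, an immersed closed curve $\Gamma$ in the open half-plane $\{(r,z):r>0\}$. The $F$-functional is $F(\Sigma)=\frac1{4\pi}\int_\Sigma e^{-|x|^2/4}$; the entropy is $\sup_{x_0\in\mathbb{R}^3,\,t_0>0}F(x_0+\sqrt{t_0}\,\Sigma)$, which for a self-shrinker equals $F(\Sigma)$. *)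

theory Defs
  imports "HOL-Analysis.Analysis"
begin

section \<open>Parametrized surfaces in Euclidean 3-space\<close>

definition partial1 :: "(real \<Rightarrow> real \<Rightarrow> real^3) \<Rightarrow> real \<Rightarrow> real \<Rightarrow> real^3" where
  "partial1 X u v = vector_derivative (\<lambda>s. X s v) (at u)"

definition partial2 :: "(real \<Rightarrow> real \<Rightarrow> real^3) \<Rightarrow> real \<Rightarrow> real \<Rightarrow> real^3" where
  "partial2 X u v = vector_derivative (\<lambda>t. X u t) (at v)"

definition unit_normal :: "(real \<Rightarrow> real \<Rightarrow> real^3) \<Rightarrow> real \<Rightarrow> real \<Rightarrow> real^3" where
  "unit_normal X u v = sgn (cross3 (partial1 X u v) (partial2 X u v))"

text \<open>
  With \<open>g\<close> the first fundamental form and \<open>a\<close> the second fundamental form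
  \<open>A(v, w) = \<langle>\<nabla>\<^sub>v w, n\<rangle>\<close> in the coordinate frame, the trace of \<open>A\<close> with respect to the
  induced metric is the trace of the matrix \<open>g\<inverse> a\<close>, written out below. The mean curvature is
  \<open>H = - tr A\<close>, which is positive on round spheres with the outward normal.
\<close>

definition mean_curvature :: "(real \<Rightarrow> real \<Rightarrow> real^3) \<Rightarrow> real \<Rightarrow> real \<Rightarrow> real" where
  "mean_curvature X u v =
    (let g11 = partial1 X u v \<bullet> partial1 X u v;
         g12 = partial1 X u v \<bullet> partial2 X u v;
         g22 = partial2 X u v \<bullet> partial2 X u v;
         a11 = partial1 (partial1 X) u v \<bullet> unit_normal X u v;
         a12 = partial1 (partial2 X) u v \<bullet> unit_normal X u v;
         a22 = partial2 (partial2 X) u v \<bullet> unit_normal X u v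
     in - ((g22 * a11 - 2 * g12 * a12 + g11 * a22) / (g11 * g22 - g12\<^sup>2)))"

text \<open>
  Both sides of the equation change sign with the normal, so the choice of
  orientation is immaterial.
\<close>

definition self_shrinker :: "(real \<Rightarrow> real \<Rightarrow> real^3) \<Rightarrow> bool" where
  "self_shrinker X \<longleftrightarrow> (\<forall>u v. mean_curvature X u v = (X u v \<bullet> unit_normal X u v) / 2)"

text \<open>
  The Gaussian area of the surface parametrized by \<open>X\<close> over \<open>D\<close>; the area element is
  \<open>\<bar>X\<^sub>u \<times> X\<^sub>v\<bar> du dv\<close>, so an immersed surface is counted with multiplicity.
\<close>

definition F_functional :: "(real \<times> real) set \<Rightarrow> (real \<Rightarrow> real \<Rightarrow> real^3) \<Rightarrow> real" where
  "F_functional D X = 1 / (4 * pi) *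
    (LINT p:D|lborel. exp (- (norm (X (fst p) (snd p)))\<^sup>2 / 4) *
       norm (cross3 (partial1 X (fst p) (snd p)) (partial2 X (fst p) (snd p))))"

text \<open>The supremum is taken in the extended reals, where it exists without a boundedness proof.\<close>

definition entropy :: "(real \<times> real) set \<Rightarrow> (real \<Rightarrow> real \<Rightarrow> real^3) \<Rightarrow> ereal" where
  "entropy D X = (SUP (x0, t0) \<in> (UNIV :: (real^3) set) \<times> {0<..}.
     ereal (F_functional D (\<lambda>u v. x0 + sqrt t0 *\<^sub>R X u v)))"

section \<open>Rotationally symmetric tori\<close>

definition smooth :: "(real \<Rightarrow> real) \<Rightarrow> bool" where
  "smooth f \<longleftrightarrow> (\<forall>k x. ((deriv ^^ k) f) differentiable (at x))"

text \<open>
  A smooth immersed closed curve \<open>s \<mapsto> (r, z) = (\<rho> s, \<zeta> s)\<close> in the open half-plane \<open>r > 0\<close>,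
  given as a regular \<open>L\<close>-periodic parametrization; it may have self-intersections.
\<close>

definition closed_profile_curve :: "real \<Rightarrow> (real \<Rightarrow> real) \<Rightarrow> (real \<Rightarrow> real) \<Rightarrow> bool" where
  "closed_profile_curve L \<rho> \<zeta> \<longleftrightarrow>
     0 < L \<and> smooth \<rho> \<and> smooth \<zeta> \<and>
     (\<forall>s. \<rho> (s + L) = \<rho> s \<and> \<zeta> (s + L) = \<zeta> s) \<and>
     (\<forall>s. 0 < \<rho> s) \<and>
     (\<forall>s. (deriv \<rho> s, deriv \<zeta> s) \<noteq> (0, 0))"

definition surface_of_revolution ::
    "(real \<Rightarrow> real) \<Rightarrow> (real \<Rightarrow> real) \<Rightarrow> real \<Rightarrow> real \<Rightarrow> real^3" where
  "surface_of_revolution \<rho> \<zeta> s \<theta> = vector [\<rho> s * cos \<theta>, \<rho> s * sin \<theta>, \<zeta> s]"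

text \<open>One fundamental domain of the doubly periodic parametrization.\<close>

definition torus_domain :: "real \<Rightarrow> (real \<times> real) set" where
  "torus_domain L = {0..L} \<times> {0..2 * pi}"

definition torus_points :: "real \<Rightarrow> (real \<Rightarrow> real) \<Rightarrow> (real \<Rightarrow> real) \<Rightarrow> (real^3) set" where
  "torus_points L \<rho> \<zeta> = (\<lambda>(s, \<theta>). surface_of_revolution \<rho> \<zeta> s \<theta>) ` torus_domain L"

definition axis_dist :: "real^3 \<Rightarrow> real" where
  "axis_dist x = sqrt ((x $ 1)\<^sup>2 + (x $ 2)\<^sup>2)"

definition weight :: "real^3 \<Rightarrow> real" where
  "weight x = axis_dist x * exp (- (norm x)\<^sup>2 / 4)"

end

theory Submission
  imports Defs
begin

text \<open>
  Write \<open>w = r exp (- \<bar>x\<bar>\<^sup>2 / 4)\<close>. Integrating out the angle of rotation turns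
  \<open>F(\<Sigma>)\<close> into half the length of the profile curve in the metric
  \<open>w\<^sup>2 (dr\<^sup>2 + dz\<^sup>2)\<close>, and the shrinker equation says that the profile curve is a
  closed geodesic of this metric. Its two components give two second order equations along the
  curve, of which the one for the height is linear in the height: with \<open>\<sigma>\<close> the Euclidean
  speed, \<open>((w / \<sigma>) \<zeta>')' = - w \<sigma> \<zeta> / 2\<close>
  (\<open>weighted_slope_derivative\<close>).

  In the parameter \<open>\<tau>\<close> with \<open>d\<tau> = (\<sigma> / w) ds\<close> this is the Hill equation
  \<open>\<zeta>\<^sub>\<tau>\<^sub>\<tau> + q \<zeta> = 0\<close> with \<open>q = w\<^sup>2 / 2\<close>, and
  \<open>F(\<Sigma>)\<close> is the integral of \<open>q\<close> over one period. The height is a nonzero periodic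
  solution, because a closed immersed curve cannot stay on the line \<open>z = 0\<close>. Hence its
  phase point \<open>(\<zeta>\<^sub>\<tau> / k, \<zeta>)\<close> runs along a closed curve that avoids the origin
  and, as \<open>q > 0\<close>, always turns in the same direction, so the Pruefer angle of this curve
  grows by at least \<open>2 \<pi>\<close> over a period. If \<open>k\<^sup>2\<close> is the minimum of \<open>q\<close>, the
  angle grows at a rate \<open>k cos\<^sup>2 + (q / k) sin\<^sup>2 \<le> q / k\<close>, so that
  \<open>F(\<Sigma>) \<ge> 2 \<pi> k = \<pi> sqrt 2 min w\<close>
  (\<open>periodic_system_integral_ge_2pi\<close>). Equality forces the velocity component of the
  phase point to vanish wherever \<open>q > k\<^sup>2\<close>. It would vanish on a whole interval, which the
  turning forbids; so equality is possible only for constant \<open>w\<close>.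
\<close>

section \<open>The Pruefer angle of a periodic planar linear system\<close>

text \<open>
  The increase of the argument along a closed curve is an integer multiple of \<open>2 \<pi>\<close>,
  and one that is positive is at least \<open>2 \<pi>\<close>. The integrality is seen by exponentiating
  the integral of the logarithmic derivative.
\<close>

lemma closed_curve_angle_ge_2pi:
  fixes p p' :: "real \<Rightarrow> complex"
  assumes "0 < L"
    and der: "\<And>s. s \<in> {0..L} \<Longrightarrow> (p has_vector_derivative p' s) (at s within {0..L})"
    and cont: "continuous_on {0..L} p'"
    and nz: "\<And>s. s \<in> {0..L} \<Longrightarrow> p s \<noteq> 0"
    and closed: "p L = p 0"
    and pos: "\<And>s. s \<in> {0..L} \<Longrightarrow> 0 < Im (p' s / p s)"
  shows "2 * pi \<le> integral {0..L} (\<lambda>s. Im (p' s / p s))"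
proof -
  define q where "q s = p' s / p s" for s
  define I where "I s = integral {0..s} q" for s
  have contp: "continuous_on {0..L} p"
    using der has_vector_derivative_continuous continuous_on_eq_continuous_within by blast
  have contq: "continuous_on {0..L} q"
    unfolding q_def using nz by (intro continuous_intros contp cont) auto
  have derI: "(I has_vector_derivative q s) (at s within {0..L})" if "s \<in> {0..L}" for s
    unfolding I_def using integral_has_vector_derivative[OF contq that] .
  (* p is its initial value times exp of the integral of its logarithmic derivative *)
  have "((\<lambda>s. p s * exp (- I s)) has_vector_derivative 0) (at s within {0..L})"
    if s: "s \<in> {0..L}" for s
  proof -
    have e: "((\<lambda>s. exp (- I s)) has_vector_derivative (- q s * exp (- I s))) (at s within {0..L})"
      using field_vector_diff_chain_within[of "\<lambda>s. - I s" "- q s" s "{0..L}" exp "exp (- I s)",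
          OF has_vector_derivative_minus[OF derI[OF s]] has_field_derivative_at_within[OF DERIV_exp]]
      by (simp add: o_def)
    have "((\<lambda>s. p s * exp (- I s)) has_vector_derivative
        (p s * (- q s * exp (- I s)) + p' s * exp (- I s))) (at s within {0..L})"
      by (rule has_vector_derivative_mult[OF der[OF s] e])
    moreover have "p s * (- q s * exp (- I s)) + p' s * exp (- I s) = 0"
      using nz[OF s] by (simp add: q_def)
    ultimately show ?thesis by simp
  qed
  then obtain k where k: "\<And>s. s \<in> {0..L} \<Longrightarrow> p s * exp (- I s) = k"
    using has_vector_derivative_zero_constant[of "{0..L}" "\<lambda>s. p s * exp (- I s)"] by auto
  have "p L * exp (- I L) = p 0 * exp (- I 0)"
    using k[of L] k[of 0] \<open>0 < L\<close> by simp
  then have "exp (- I L) = 1"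
    using closed nz[of 0] \<open>0 < L\<close> by (simp add: I_def)
  then have "exp (I L) = 1" by (simp add: exp_minus)
  then obtain n :: int where n: "Im (I L) = of_int (2 * n) * pi"
    using exp_eq_1 by auto
  have intq: "q integrable_on {0..L}"
    by (rule integrable_continuous_real[OF contq])
  have Im_I: "Im (I L) = integral {0..L} (\<lambda>s. Im (q s))"
    unfolding I_def using integral_linear[OF intq bounded_linear_Im] by (simp add: o_def)
  have "0 < integral {0..L} (\<lambda>s. Im (q s))"
  proof -
    have c: "continuous_on {0..L} (\<lambda>s. Im (q s))"
      by (intro continuous_intros contq)
    have nn: "0 \<le> integral {0..L} (\<lambda>s. Im (q s))"
      by (rule Henstock_Kurzweil_Integration.integral_nonneg)
        (use pos integrable_continuous_real[OF c] in \<open>auto simp: q_def less_imp_le\<close>)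
    moreover have "integral {0..L} (\<lambda>s. Im (q s)) \<noteq> 0"
      using integral_eq_0_iff[OF c] pos \<open>0 < L\<close> by (force simp: q_def less_imp_le)
    ultimately show ?thesis by simp
  qed
  then have "0 < of_int n * pi" using n Im_I by (simp add: mult.commute)
  then have "1 \<le> n" by (simp add: zero_less_mult_iff)
  then have "1 * pi \<le> of_int n * pi" by (intro mult_right_mono) auto
  then show ?thesis using n Im_I by (simp add: q_def)
qed

text \<open>
  A solution through the origin is the zero solution. With \<open>K\<close> a bound for \<open>\<bar>a - b\<bar>\<close>,
  the function \<open>N = u\<^sup>2 + v\<^sup>2\<close> satisfies \<open>\<bar>N'\<bar> \<le> K N\<close>, so
  \<open>N exp (- K s)\<close> decreases and \<open>N exp (K s)\<close> increases; the first carries the zero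
  forward, the second backward.
\<close>

lemma linear_system_zero_propagates:
  fixes u v a b :: "real \<Rightarrow> real"
  assumes du: "\<And>s. s \<in> {0..L} \<Longrightarrow> (u has_real_derivative a s * v s) (at s)"
    and dv: "\<And>s. s \<in> {0..L} \<Longrightarrow> (v has_real_derivative - b s * u s) (at s)"
    and ca: "continuous_on {0..L} a" and cb: "continuous_on {0..L} b"
    and t: "t \<in> {0..L}" "u t = 0" "v t = 0" and s: "s \<in> {0..L}"
  shows "u s = 0 \<and> v s = 0"
proof -
  define N where "N s = (u s)\<^sup>2 + (v s)\<^sup>2" for s
  have "continuous_on {0..L} (\<lambda>s. \<bar>a s - b s\<bar>)"
    by (intro continuous_intros ca cb)
  then have "bounded ((\<lambda>s. \<bar>a s - b s\<bar>) ` {0..L})"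
    by (intro compact_imp_bounded compact_continuous_image) auto
  then obtain K where "\<forall>x\<in>(\<lambda>s. \<bar>a s - b s\<bar>) ` {0..L}. norm x \<le> K"
    unfolding bounded_iff by blast
  then have K: "\<bar>a s - b s\<bar> \<le> K" if "s \<in> {0..L}" for s
    using that by auto
  define N' where "N' s = (a s - b s) * (2 * (u s * v s))" for s
  have dN: "(N has_real_derivative N' s) (at s)" if "s \<in> {0..L}" for s
    unfolding N_def N'_def
    by (rule derivative_eq_intros du[OF that] dv[OF that] refl | simp add: algebra_simps)+
  have bound: "\<bar>N' s\<bar> \<le> K * N s" if "s \<in> {0..L}" for s
  proof -
    have uv: "\<bar>2 * (u s * v s)\<bar> \<le> N s"
      unfolding N_def using sum_squares_bound[of "u s" "v s"] sum_squares_bound[of "u s" "- v s"]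
      by (auto simp: abs_le_iff)
    have "\<bar>N' s\<bar> = \<bar>a s - b s\<bar> * \<bar>2 * (u s * v s)\<bar>"
      unfolding N'_def by (rule abs_mult)
    also have "\<dots> \<le> K * N s"
      by (intro mult_mono K that uv) (use K[OF that] in auto)
    finally show ?thesis .
  qed
  have dE: "((\<lambda>x. N x * exp (k * x)) has_real_derivative (N' x + k * N x) * exp (k * x)) (at x)"
    if "x \<in> {0..L}" for x k
    by (rule derivative_eq_intros dN[OF that] refl | simp add: algebra_simps)+
  have Nt: "N t = 0" using t by (simp add: N_def)
  have "N s \<le> 0"
  proof (cases "t \<le> s")
    case True
    have "N s * exp (- K * s) \<le> N t * exp (- K * t)"
    proof (rule DERIV_nonpos_imp_nonincreasing[OF True])
      fix x assume "t \<le> x" "x \<le> s"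
      then have x: "x \<in> {0..L}" using s t by auto
      then have "(N' x + - K * N x) * exp (- K * x) \<le> 0"
        using bound[OF x] by (intro mult_nonpos_nonneg) auto
      then show "\<exists>y. ((\<lambda>x. N x * exp (- K * x)) has_real_derivative y) (at x) \<and> y \<le> 0"
        using dE[OF x, of "- K"] by blast
    qed
    then show ?thesis by (simp add: Nt mult_le_0_iff not_le)
  next
    case False
    then have "s \<le> t" by simp
    have "N s * exp (K * s) \<le> N t * exp (K * t)"
    proof (rule DERIV_nonneg_imp_nondecreasing[OF \<open>s \<le> t\<close>])
      fix x assume "s \<le> x" "x \<le> t"
      then have x: "x \<in> {0..L}" using s t by auto
      then have "0 \<le> (N' x + K * N x) * exp (K * x)"
        using bound[OF x] by (intro mult_nonneg_nonneg) auto
      then show "\<exists>y. ((\<lambda>x. N x * exp (K * x)) has_real_derivative y) (at x) \<and> 0 \<le> y"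
        using dE[OF x, of K] by blast
    qed
    then show ?thesis by (simp add: Nt mult_le_0_iff not_le)
  qed
  then show ?thesis
    unfolding N_def by (metis sum_power2_le_zero_iff)
qed

text \<open>
  The angle of \<open>v + i u\<close> turns at the rate
  \<open>\<omega> = (a v\<^sup>2 + b u\<^sup>2) / (u\<^sup>2 + v\<^sup>2)\<close>, an average of \<open>a\<close> and \<open>b\<close>, which is
  positive and at most \<open>b\<close>. By periodicity its integral is at least \<open>2 \<pi>\<close>. Since
  \<open>b - \<omega>\<close> is a positive multiple of \<open>(b - a) v\<^sup>2\<close>, equality would make \<open>v\<close> vanish
  near a point with \<open>a < b\<close>, and then \<open>v' = - b u\<close> would make \<open>u\<close> vanish there too.
\<close>

lemma periodic_system_integral_ge_2pi:
  fixes u v a b :: "real \<Rightarrow> real"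
  assumes "0 < L"
    and du: "\<And>s. s \<in> {0..L} \<Longrightarrow> (u has_real_derivative a s * v s) (at s)"
    and dv: "\<And>s. s \<in> {0..L} \<Longrightarrow> (v has_real_derivative - b s * u s) (at s)"
    and ca: "continuous_on {0..L} a" and cb: "continuous_on {0..L} b"
    and a: "\<And>s. s \<in> {0..L} \<Longrightarrow> 0 < a s" and ab: "\<And>s. s \<in> {0..L} \<Longrightarrow> a s \<le> b s"
    and per: "u L = u 0" "v L = v 0"
    and nt: "t \<in> {0..L}" "u t \<noteq> 0"
  shows "2 * pi \<le> integral {0..L} b"
    and "s \<in> {0..L} \<Longrightarrow> a s < b s \<Longrightarrow> 2 * pi < integral {0..L} b"
proof -
  define N where "N s = (u s)\<^sup>2 + (v s)\<^sup>2" for s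
  have N: "0 < N s" if "s \<in> {0..L}" for s
    using linear_system_zero_propagates[OF du dv ca cb that _ _ nt(1)] nt(2)
    unfolding N_def by (metis sum_power2_gt_zero_iff)
  define \<omega> where "\<omega> s = (a s * (v s)\<^sup>2 + b s * (u s)\<^sup>2) / N s" for s
  have cu: "continuous_on {0..L} u" and cv: "continuous_on {0..L} v"
    using du dv by (meson DERIV_isCont continuous_at_imp_continuous_on)+
  have c\<omega>: "continuous_on {0..L} \<omega>"
    unfolding \<omega>_def using N unfolding N_def
    by (intro continuous_intros ca cb cu cv) force
  have b: "0 < b s" if "s \<in> {0..L}" for s using a ab that by force
  have \<omega>_pos: "0 < \<omega> s" if "s \<in> {0..L}" for s
  proof -
    have "0 < a s * (v s)\<^sup>2 + b s * (u s)\<^sup>2"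
    proof (cases "v s = 0")
      case True
      then show ?thesis using N[OF that] b[OF that] by (simp add: N_def)
    next
      case False
      then have "0 < a s * (v s)\<^sup>2" using a[OF that] by simp
      moreover have "0 \<le> b s * (u s)\<^sup>2" using b[OF that] by simp
      ultimately show ?thesis by linarith
    qed
    then show ?thesis using N[OF that] by (simp add: \<omega>_def)
  qed
  define p where "p s = complex_of_real (v s) + \<i> * of_real (u s)" for s
  define p' where "p' s = complex_of_real (- b s * u s) + \<i> * of_real (a s * v s)" for s
  have Im_eq: "Im (p' s / p s) = \<omega> s" if "s \<in> {0..L}" for s
    by (simp add: p_def p'_def \<omega>_def N_def Im_divide power2_eq_square algebra_simps)
  have "2 * pi \<le> integral {0..L} (\<lambda>s. Im (p' s / p s))"
  proof (rule closed_curve_angle_ge_2pi[OF \<open>0 < L\<close>])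
    fix s assume s: "s \<in> {0..L}"
    show "(p has_vector_derivative p' s) (at s within {0..L})"
      unfolding p_def p'_def
      using has_vector_derivative_of_real[OF du[OF s]] has_vector_derivative_of_real[OF dv[OF s]]
      by (intro has_vector_derivative_at_within[OF has_vector_derivative_add]
          has_vector_derivative_mult_right)
    show "p s \<noteq> 0" using N[OF s] by (auto simp: p_def N_def complex_eq_iff)
    show "0 < Im (p' s / p s)" using Im_eq[OF s] \<omega>_pos[OF s] by simp
  next
    show "continuous_on {0..L} p'" unfolding p'_def
      by (intro continuous_intros ca cb cu cv)
    show "p L = p 0" by (simp add: p_def per)
  qed
  also have "\<dots> = integral {0..L} \<omega>"
    using Im_eq by (rule integral_cong)
  finally have angle: "2 * pi \<le> integral {0..L} \<omega>" .
  have diff: "b s - \<omega> s = (b s - a s) * (v s)\<^sup>2 / N s" if "s \<in> {0..L}" for s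
  proof -
    have "b s - \<omega> s = (b s * N s - (a s * (v s)\<^sup>2 + b s * (u s)\<^sup>2)) / N s"
      using N[OF that] by (simp add: \<omega>_def diff_divide_distrib)
    also have "b s * N s - (a s * (v s)\<^sup>2 + b s * (u s)\<^sup>2) = (b s - a s) * (v s)\<^sup>2"
      by (simp add: N_def algebra_simps)
    finally show ?thesis .
  qed
  have nonneg: "0 \<le> b s - \<omega> s" if "s \<in> {0..L}" for s
    unfolding diff[OF that] using N[OF that] ab[OF that] by simp
  have cd: "continuous_on {0..L} (\<lambda>s. b s - \<omega> s)"
    by (intro continuous_intros cb c\<omega>)
  have int_diff: "integral {0..L} b - integral {0..L} \<omega> = integral {0..L} (\<lambda>s. b s - \<omega> s)"
    by (rule Henstock_Kurzweil_Integration.integral_diff[symmetric])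
      (intro integrable_continuous_real cb c\<omega>)+
  have "0 \<le> integral {0..L} (\<lambda>s. b s - \<omega> s)"
    by (rule Henstock_Kurzweil_Integration.integral_nonneg)
      (use nonneg integrable_continuous_real[OF cd] in auto)
  with angle int_diff show le: "2 * pi \<le> integral {0..L} b" by linarith
  show "2 * pi < integral {0..L} b" if s: "s \<in> {0..L}" and lt: "a s < b s"
  proof (rule ccontr)
    assume "\<not> 2 * pi < integral {0..L} b"
    then have "integral {0..L} (\<lambda>s. b s - \<omega> s) = 0"
      using le angle int_diff \<open>0 \<le> integral {0..L} (\<lambda>s. b s - \<omega> s)\<close> by linarith
    then have eq: "\<And>x. x \<in> {0..L} \<Longrightarrow> b x - \<omega> x = 0"
      using integral_eq_0_iff[OF cd \<open>0 < L\<close> nonneg] by blast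
    have v0: "v x = 0" if "x \<in> {0..L}" "a x < b x" for x
      using eq[OF that(1)] diff[OF that(1)] N[OF that(1)] that(2) by simp
    have "continuous_on {0..L} (\<lambda>x. b x - a x)"
      by (intro continuous_intros ca cb)
    then obtain d where d: "0 < d"
        "\<And>x. x \<in> {0..L} \<Longrightarrow> dist x s < d \<Longrightarrow> dist (b x - a x) (b s - a s) < b s - a s"
      using s lt unfolding continuous_on_iff by (metis diff_gt_0_iff_gt)
    have "v x = 0" if "x \<in> {0..L}" "dist x s < d" for x
      using v0[OF that(1)] d(2)[OF that] by (simp add: dist_real_def abs_less_iff)
    then have "((\<lambda>_. 0) has_real_derivative - b s * u s) (at s within {0..L})"
      by (intro has_field_derivative_transform_within[OF
            has_field_derivative_at_within[OF dv[OF s]] d(1) s]) auto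
    then have deriv_v: "((\<lambda>_. 0) has_vector_derivative - b s * u s) (at s within cbox 0 L)"
      by (simp add: has_real_derivative_iff_has_vector_derivative)
    have "- b s * u s = 0"
      by (rule vector_derivative_unique_within_closed_interval[OF \<open>0 < L\<close> _ deriv_v
            has_vector_derivative_const])
        (use s in auto)
    then have "u s = 0" using b[OF s] by simp
    then show False using v0[OF s lt] N[OF s] by (simp add: N_def)
  qed
qed

section \<open>Geometry of surfaces of revolution\<close>

definition speed :: "(real \<Rightarrow> real) \<Rightarrow> (real \<Rightarrow> real) \<Rightarrow> real \<Rightarrow> real" where
  "speed f' g' s = sqrt ((f' s)\<^sup>2 + (g' s)\<^sup>2)"

definition profile_weight :: "(real \<Rightarrow> real) \<Rightarrow> (real \<Rightarrow> real) \<Rightarrow> real \<Rightarrow> real" where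
  "profile_weight f g s = f s * exp (- ((f s)\<^sup>2 + (g s)\<^sup>2) / 4)"

lemma has_vector_derivative_vector3:
  assumes "(a has_real_derivative a') (at s)" "(b has_real_derivative b') (at s)"
    "(c has_real_derivative c') (at s)"
  shows "((\<lambda>s. vector [a s, b s, c s] :: real^3) has_vector_derivative vector [a', b', c']) (at s)"
proof -
  have vec: "(vector [x, y, z] :: real^3) = x *\<^sub>R vector [1, 0, 0] + y *\<^sub>R vector [0, 1, 0] + z *\<^sub>R vector [0, 0, 1 :: real]"
    for x y z :: real unfolding vec_eq_iff forall_3 by simp
  show ?thesis
    unfolding vec[of "a _"] vec[of a']
    by (rule derivative_eq_intros assms refl | simp)+
qed

text \<open>
  Differentiation along the meridian yields again a parametrization of the same form, which makes
  the lemma applicable a second time for the second derivative.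
\<close>

lemma partial1_surface_of_revolution:
  assumes "\<And>s. (f has_real_derivative f' s) (at s)" "\<And>s. (g has_real_derivative g' s) (at s)"
  shows "partial1 (surface_of_revolution f g) = surface_of_revolution f' g'"
  unfolding partial1_def surface_of_revolution_def fun_eq_iff
  by (intro allI vector_derivative_at has_vector_derivative_vector3)
    (rule derivative_eq_intros assms refl | simp)+

lemma partial2_surface_of_revolution:
  "partial2 (surface_of_revolution f g) = (\<lambda>s \<theta>. vector [- f s * sin \<theta>, f s * cos \<theta>, 0])"
  unfolding partial2_def surface_of_revolution_def fun_eq_iff
  by (intro allI vector_derivative_at has_vector_derivative_vector3)
    (rule derivative_eq_intros refl | simp)+

lemma cross3_surface_of_revolution:
  "cross3 (surface_of_revolution f' g' s \<theta>) (vector [- r * sin \<theta>, r * cos \<theta>, 0])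
    = r *\<^sub>R vector [- g' s * cos \<theta>, - g' s * sin \<theta>, f' s]"
proof -
  have "r * (cos \<theta> * (cos \<theta> * f' s)) + r * (sin \<theta> * (sin \<theta> * f' s)) = r * f' s"
    using sin_cos_squared_add[of \<theta>] by algebra
  then show ?thesis
    by (simp add: cross3_def surface_of_revolution_def vec_eq_iff forall_3 algebra_simps)
qed

lemma norm_vector3_polar:
  "norm (vector [x * cos \<theta>, x * sin \<theta>, y] :: real^3) = sqrt (x\<^sup>2 + y\<^sup>2)"
proof -
  have "(x * cos \<theta>)\<^sup>2 + (x * sin \<theta>)\<^sup>2 = x\<^sup>2 * ((cos \<theta>)\<^sup>2 + (sin \<theta>)\<^sup>2)"
    by (simp only: power_mult_distrib distrib_left)
  then have "(x * cos \<theta>)\<^sup>2 + (x * sin \<theta>)\<^sup>2 = x\<^sup>2" by simp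
  then show ?thesis by (simp add: norm_vec_def L2_set_def sum_3)
qed

lemma norm_surface_of_revolution:
  "norm (surface_of_revolution f g s \<theta>) = sqrt ((f s)\<^sup>2 + (g s)\<^sup>2)"
  unfolding surface_of_revolution_def by (rule norm_vector3_polar)

lemma norm_cross3_surface_of_revolution:
  assumes "0 \<le> r"
  shows "norm (cross3 (surface_of_revolution f' g' s \<theta>) (vector [- r * sin \<theta>, r * cos \<theta>, 0]))
    = r * sqrt ((f' s)\<^sup>2 + (g' s)\<^sup>2)"
  unfolding cross3_surface_of_revolution norm_scaleR norm_vector3_polar
  using assms by (simp add: add.commute)

lemma weight_surface_of_revolution:
  assumes "0 \<le> f s"
  shows "weight (surface_of_revolution f g s \<theta>) = profile_weight f g s"
proof -
  have "(f s * cos \<theta>)\<^sup>2 + (f s * sin \<theta>)\<^sup>2 = (f s)\<^sup>2 * ((cos \<theta>)\<^sup>2 + (sin \<theta>)\<^sup>2)"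
    by (simp only: power_mult_distrib distrib_left)
  then have "axis_dist (surface_of_revolution f g s \<theta>) = f s"
    using assms by (simp add: axis_dist_def surface_of_revolution_def)
  then show ?thesis by (simp add: weight_def profile_weight_def norm_surface_of_revolution)
qed

text \<open>
  This is the equation \<open>H = \<langle>x, n\<rangle> / 2\<close> with the curvature of the meridian isolated. By
  symmetry it suffices to evaluate it at angle \<open>0\<close>. There the coordinate frame is orthogonal
  and the mixed second derivative is tangential, so that only the two principal curvatures remain:
  that of the profile curve, and that of the parallel circle.
\<close>

lemma profile_curve_equation:
  fixes \<rho> \<zeta> :: "real \<Rightarrow> real"
  assumes d1: "\<And>s. (\<rho> has_real_derivative \<rho>' s) (at s)" "\<And>s. (\<zeta> has_real_derivative \<zeta>' s) (at s)"
    and d2: "\<And>s. (\<rho>' has_real_derivative \<rho>'' s) (at s)" "\<And>s. (\<zeta>' has_real_derivative \<zeta>'' s) (at s)"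
    and pos: "0 < \<rho> s" and reg: "(\<rho>' s)\<^sup>2 + (\<zeta>' s)\<^sup>2 \<noteq> 0"
    and shr: "self_shrinker (surface_of_revolution \<rho> \<zeta>)"
  shows "\<zeta>'' s * \<rho>' s - \<rho>'' s * \<zeta>' s =
    ((\<rho>' s)\<^sup>2 + (\<zeta>' s)\<^sup>2) * ((\<rho> s * \<zeta>' s - \<zeta> s * \<rho>' s) / 2 - \<zeta>' s / \<rho> s)"
proof -
  define X where "X = surface_of_revolution \<rho> \<zeta>"
  define \<sigma> where "\<sigma> = sqrt ((\<rho>' s)\<^sup>2 + (\<zeta>' s)\<^sup>2)"
  have \<sigma>2: "\<sigma>\<^sup>2 = (\<rho>' s)\<^sup>2 + (\<zeta>' s)\<^sup>2" by (simp add: \<sigma>_def)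
  have \<sigma>: "0 < \<sigma>" using reg by (auto simp: \<sigma>_def less_le)
  have X1: "partial1 X = surface_of_revolution \<rho>' \<zeta>'"
    unfolding X_def by (rule partial1_surface_of_revolution[OF d1])
  have X11: "partial1 (partial1 X) = surface_of_revolution \<rho>'' \<zeta>''"
    unfolding X1 by (rule partial1_surface_of_revolution[OF d2])
  have X2: "partial2 X = (\<lambda>s \<theta>. vector [- \<rho> s * sin \<theta>, \<rho> s * cos \<theta>, 0])"
    unfolding X_def by (rule partial2_surface_of_revolution)
  have X12: "partial1 (partial2 X) s 0 = vector [0, \<rho>' s, 0]"
    unfolding X2 partial1_def
    by (intro vector_derivative_at has_vector_derivative_vector3)
      (rule derivative_eq_intros d1 refl | simp)+
  have X22: "partial2 (partial2 X) s 0 = vector [- \<rho> s, 0, 0]"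
    unfolding X2 partial2_def
    by (intro vector_derivative_at has_vector_derivative_vector3)
      (rule derivative_eq_intros refl | simp)+
  have n: "unit_normal X s 0 = vector [- \<zeta>' s / \<sigma>, 0, \<rho>' s / \<sigma>]"
    unfolding unit_normal_def X1 X2 sgn_div_norm norm_cross3_surface_of_revolution[OF less_imp_le[OF pos]]
    unfolding cross3_surface_of_revolution \<sigma>_def[symmetric]
    using pos \<sigma> by (simp add: vec_eq_iff forall_3 field_simps)
  have "mean_curvature X s 0 = - (((\<rho> s)\<^sup>2 * ((\<zeta>'' s * \<rho>' s - \<rho>'' s * \<zeta>' s) / \<sigma>)
      + \<sigma>\<^sup>2 * (\<rho> s * \<zeta>' s / \<sigma>)) / (\<sigma>\<^sup>2 * (\<rho> s)\<^sup>2))"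
    unfolding mean_curvature_def Let_def n X11 X12 X22 \<sigma>2
    unfolding X1 X2
    by (simp add: surface_of_revolution_def inner_vec_def sum_3 power2_eq_square diff_divide_distrib algebra_simps)
  also have "\<dots> = - ((\<zeta>'' s * \<rho>' s - \<rho>'' s * \<zeta>' s) / \<sigma> ^ 3 + \<zeta>' s / (\<rho> s * \<sigma>))"
    using pos \<sigma> by (simp add: field_simps power2_eq_square power3_eq_cube)
  finally have H: "mean_curvature X s 0 =
      - ((\<zeta>'' s * \<rho>' s - \<rho>'' s * \<zeta>' s) / \<sigma> ^ 3 + \<zeta>' s / (\<rho> s * \<sigma>))" .
  have "X s 0 \<bullet> unit_normal X s 0 = (\<zeta> s * \<rho>' s - \<rho> s * \<zeta>' s) / \<sigma>"
    unfolding n by (simp add: X_def surface_of_revolution_def inner_vec_def sum_3 diff_divide_distrib)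
  with H shr have "- ((\<zeta>'' s * \<rho>' s - \<rho>'' s * \<zeta>' s) / \<sigma> ^ 3 + \<zeta>' s / (\<rho> s * \<sigma>))
      = (\<zeta> s * \<rho>' s - \<rho> s * \<zeta>' s) / \<sigma> / 2"
    unfolding self_shrinker_def X_def by metis
  then have "(\<zeta>'' s * \<rho>' s - \<rho>'' s * \<zeta>' s) / \<sigma> ^ 3 =
      ((\<rho> s * \<zeta>' s - \<zeta> s * \<rho>' s) / 2 - \<zeta>' s / \<rho> s) / \<sigma>"
    using \<sigma> pos by (simp add: diff_divide_distrib add_divide_distrib algebra_simps)
  then have "\<zeta>'' s * \<rho>' s - \<rho>'' s * \<zeta>' s =
      \<sigma> ^ 3 * (((\<rho> s * \<zeta>' s - \<zeta> s * \<rho>' s) / 2 - \<zeta>' s / \<rho> s) / \<sigma>)"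
    using \<sigma> by (simp add: field_simps)
  also have "\<dots> = \<sigma>\<^sup>2 * ((\<rho> s * \<zeta>' s - \<zeta> s * \<rho>' s) / 2 - \<zeta>' s / \<rho> s)"
    using \<sigma> by (simp add: power2_eq_square power3_eq_cube)
  finally show ?thesis unfolding \<sigma>2 .
qed

text \<open>
  The integrand is independent of the angle, which contributes the factor \<open>2 \<pi>\<close>.
\<close>

lemma F_functional_surface_of_revolution:
  fixes \<rho> \<zeta> :: "real \<Rightarrow> real"
  assumes d: "\<And>s. (\<rho> has_real_derivative \<rho>' s) (at s)" "\<And>s. (\<zeta> has_real_derivative \<zeta>' s) (at s)"
    and c: "continuous_on UNIV \<rho>'" "continuous_on UNIV \<zeta>'"
    and pos: "\<And>s. 0 < \<rho> s"
  shows "F_functional (torus_domain L) (surface_of_revolution \<rho> \<zeta>) =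
    integral {0..L} (\<lambda>s. profile_weight \<rho> \<zeta> s * speed \<rho>' \<zeta>' s) / 2"
proof -
  define h where "h = (\<lambda>s. profile_weight \<rho> \<zeta> s * speed \<rho>' \<zeta>' s)"
  have "continuous_on UNIV \<rho>" "continuous_on UNIV \<zeta>"
    using d by (meson DERIV_isCont continuous_at_imp_continuous_on)+
  then have ch: "continuous_on UNIV h"
    unfolding h_def profile_weight_def speed_def by (intro continuous_intros c) auto
  have c2: "continuous_on S (\<lambda>q. h (fst q))" for S :: "(real \<times> real) set"
    by (rule continuous_on_compose2[OF ch]) (auto intro: continuous_intros)
  have dom: "torus_domain L = cbox (0, 0) (L, 2 * pi)"
    by (auto simp: torus_domain_def cbox_Pair_eq)
  have "F_functional (torus_domain L) (surface_of_revolution \<rho> \<zeta>) =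
      1 / (4 * pi) * (LINT q:torus_domain L|lborel. h (fst q))"
    unfolding F_functional_def partial1_surface_of_revolution[OF d] partial2_surface_of_revolution
      norm_cross3_surface_of_revolution[OF less_imp_le[OF pos]] norm_surface_of_revolution
      h_def profile_weight_def speed_def
    by (simp add: mult_ac)
  also have "(LINT q:torus_domain L|lborel. h (fst q)) = integral (torus_domain L) (\<lambda>q. h (fst q))"
    unfolding dom
    by (intro set_borel_integral_eq_integral(2))
      (simp only: set_integrable_def borel_integrable_compact[OF compact_cbox c2])
  also have "\<dots> = integral (cbox 0 L) (\<lambda>s. integral (cbox 0 (2 * pi)) (\<lambda>\<theta>. h s))"
    unfolding dom by (subst integral_prod_continuous[OF c2]) simp
  also have "\<dots> = 2 * pi * integral {0..L} h"
    by (simp add: mult.commute)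
  finally show ?thesis by (simp add: h_def)
qed

text \<open>
  Geodesics of \<open>w\<^sup>2 (dr\<^sup>2 + dz\<^sup>2)\<close> satisfy \<open>(w T)' = \<sigma> \<nabla>w\<close> for the
  Euclidean unit tangent \<open>T\<close>. The lemma is the second component of this law, where
  \<open>\<partial>w / \<partial>z = - z w / 2\<close>. Only this component is linear in the coordinate itself. All terms
  without the factor \<open>\<zeta>\<close> cancel once the curvature is replaced by means of
  \<open>profile_curve_equation\<close>.
\<close>

lemma weighted_slope_derivative:
  fixes \<rho> \<zeta> :: "real \<Rightarrow> real"
  assumes d1: "\<And>s. (\<rho> has_real_derivative \<rho>' s) (at s)" "\<And>s. (\<zeta> has_real_derivative \<zeta>' s) (at s)"
    and d2: "\<And>s. (\<rho>' has_real_derivative \<rho>'' s) (at s)" "\<And>s. (\<zeta>' has_real_derivative \<zeta>'' s) (at s)"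
    and pos: "0 < \<rho> s" and reg: "(\<rho>' s)\<^sup>2 + (\<zeta>' s)\<^sup>2 \<noteq> 0"
    and shr: "self_shrinker (surface_of_revolution \<rho> \<zeta>)"
  shows "((\<lambda>s. profile_weight \<rho> \<zeta> s * \<zeta>' s / speed \<rho>' \<zeta>' s) has_real_derivative
    - (profile_weight \<rho> \<zeta> s * speed \<rho>' \<zeta>' s * \<zeta> s / 2)) (at s)"
proof -
  define w where "w = profile_weight \<rho> \<zeta>"
  define \<sigma> where "\<sigma> = speed \<rho>' \<zeta>'"
  have \<sigma>2: "(\<sigma> s)\<^sup>2 = (\<rho>' s)\<^sup>2 + (\<zeta>' s)\<^sup>2" by (simp add: \<sigma>_def speed_def)
  have reg': "0 < (\<rho>' s)\<^sup>2 + (\<zeta>' s)\<^sup>2" using reg by (simp add: less_le)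
  then have \<sigma>: "0 < \<sigma> s" by (simp add: \<sigma>_def speed_def)
  have dw: "(w has_real_derivative w s * (\<rho>' s / \<rho> s - (\<rho> s * \<rho>' s + \<zeta> s * \<zeta>' s) / 2)) (at s)"
    unfolding w_def profile_weight_def
    using pos by (auto intro!: derivative_eq_intros d1 simp: field_simps power2_eq_square)
  have d\<sigma>: "(\<sigma> has_real_derivative (\<rho>' s * \<rho>'' s + \<zeta>' s * \<zeta>'' s) / \<sigma> s) (at s)"
  proof -
    have "((\<lambda>s. (\<rho>' s)\<^sup>2 + (\<zeta>' s)\<^sup>2) has_real_derivative
        2 * (\<rho>' s * \<rho>'' s + \<zeta>' s * \<zeta>'' s)) (at s)"
      by (rule derivative_eq_intros d2 refl | simp)+
    from DERIV_chain2[where f = sqrt and g = "\<lambda>s. (\<rho>' s)\<^sup>2 + (\<zeta>' s)\<^sup>2" and x = s,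
        OF DERIV_real_sqrt[OF reg'] this]
    have "((\<lambda>s. sqrt ((\<rho>' s)\<^sup>2 + (\<zeta>' s)\<^sup>2)) has_real_derivative
        inverse (\<sigma> s) / 2 * (2 * (\<rho>' s * \<rho>'' s + \<zeta>' s * \<zeta>'' s))) (at s)"
      unfolding \<sigma>_def speed_def .
    moreover have "inverse x / 2 * (2 * y) = y / x" for x y :: real
      by (simp add: field_simps)
    ultimately show ?thesis
      unfolding \<sigma>_def speed_def by metis
  qed
  let ?W = "\<rho>' s / \<rho> s - (\<rho> s * \<rho>' s + \<zeta> s * \<zeta>' s) / 2"
  have "((\<lambda>s. w s * \<zeta>' s / \<sigma> s) has_real_derivative
      (((w s * ?W) * \<zeta>' s + \<zeta>'' s * w s) * \<sigma> s
        - w s * \<zeta>' s * ((\<rho>' s * \<rho>'' s + \<zeta>' s * \<zeta>'' s) / \<sigma> s)) / (\<sigma> s * \<sigma> s)) (at s)"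
    using \<sigma> by (intro DERIV_divide DERIV_mult dw d\<sigma> d2) simp
  also have "(((w s * ?W) * \<zeta>' s + \<zeta>'' s * w s) * \<sigma> s
        - w s * \<zeta>' s * ((\<rho>' s * \<rho>'' s + \<zeta>' s * \<zeta>'' s) / \<sigma> s)) / (\<sigma> s * \<sigma> s)
      = w s * (?W * \<zeta>' s * (\<sigma> s)\<^sup>2 + \<zeta>'' s * (\<sigma> s)\<^sup>2
        - \<zeta>' s * (\<rho>' s * \<rho>'' s + \<zeta>' s * \<zeta>'' s)) / (\<sigma> s) ^ 3"
  proof -
    have "((w s * W * z + z2 * w s) * \<sigma> s - w s * z * (k / \<sigma> s)) / (\<sigma> s * \<sigma> s)
      = w s * (W * z * (\<sigma> s)\<^sup>2 + z2 * (\<sigma> s)\<^sup>2 - z * k) / (\<sigma> s) ^ 3" for W z z2 k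
      using \<sigma> by (simp add: field_simps power2_eq_square power3_eq_cube)
    then show ?thesis .
  qed
  also have "\<zeta>'' s * (\<sigma> s)\<^sup>2 - \<zeta>' s * (\<rho>' s * \<rho>'' s + \<zeta>' s * \<zeta>'' s)
      = \<rho>' s * (\<zeta>'' s * \<rho>' s - \<rho>'' s * \<zeta>' s)"
    unfolding \<sigma>2 by (simp add: algebra_simps power2_eq_square)
  then have "?W * \<zeta>' s * (\<sigma> s)\<^sup>2 + \<zeta>'' s * (\<sigma> s)\<^sup>2 - \<zeta>' s * (\<rho>' s * \<rho>'' s + \<zeta>' s * \<zeta>'' s)
      = (\<sigma> s)\<^sup>2 * (?W * \<zeta>' s
        + \<rho>' s * ((\<rho> s * \<zeta>' s - \<zeta> s * \<rho>' s) / 2 - \<zeta>' s / \<rho> s))"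
    unfolding profile_curve_equation[OF d1 d2 pos reg shr] \<sigma>2[symmetric]
    by (simp add: algebra_simps)
  also have "?W * \<zeta>' s + \<rho>' s * ((\<rho> s * \<zeta>' s - \<zeta> s * \<rho>' s) / 2 - \<zeta>' s / \<rho> s)
      = - (\<zeta> s * (\<sigma> s)\<^sup>2 / 2)"
    unfolding \<sigma>2 using pos by (simp add: field_simps power2_eq_square)
  also have "w s * ((\<sigma> s)\<^sup>2 * - (\<zeta> s * (\<sigma> s)\<^sup>2 / 2)) / (\<sigma> s) ^ 3 = - (w s * \<sigma> s * \<zeta> s / 2)"
    using \<sigma> by (simp add: field_simps power2_eq_square power3_eq_cube)
  finally show ?thesis unfolding w_def \<sigma>_def .
qed

text \<open>
  On a closed curve the radius has an interior critical point, by Rolle's theorem; were the height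
  identically zero, the velocity would vanish there.
\<close>

lemma closed_curve_leaves_line:
  fixes \<rho> \<zeta> :: "real \<Rightarrow> real"
  assumes "0 < L" "\<rho> L = \<rho> 0"
    and d: "\<And>s. (\<rho> has_real_derivative \<rho>' s) (at s)" "\<And>s. (\<zeta> has_real_derivative \<zeta>' s) (at s)"
    and reg: "\<And>s. (\<rho>' s, \<zeta>' s) \<noteq> (0, 0)"
  obtains s where "s \<in> {0..L}" "\<zeta> s \<noteq> 0"
proof (rule ccontr)
  assume "\<not> thesis"
  with that have \<zeta>0: "\<And>s. s \<in> {0..L} \<Longrightarrow> \<zeta> s = 0" by blast
  have "continuous_on {0..L} \<rho>" using d(1) by (meson DERIV_isCont continuous_at_imp_continuous_on)
  moreover have "\<And>x. \<rho> differentiable (at x)"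
    using d(1) real_differentiable_def by blast
  ultimately obtain t where t: "0 < t" "t < L" "(\<rho> has_real_derivative 0) (at t)"
    using Rolle[of 0 L \<rho>] assms(1,2) by auto
  have "(\<zeta> has_real_derivative 0) (at t)"
    by (rule has_field_derivative_transform_within_open[of "\<lambda>_. 0" 0 t "{0<..<L}"])
      (use t \<zeta>0 in auto)
  then show False using t d reg[of t] DERIV_unique by blast
qed

section \<open>The entropy bound\<close>

lemma smooth_has_derivs:
  assumes "smooth f"
  shows "(f has_real_derivative deriv f s) (at s)"
    and "(deriv f has_real_derivative deriv (deriv f) s) (at s)"
proof -
  have "((deriv ^^ 0) f) differentiable (at s)" "((deriv ^^ 1) f) differentiable (at s)"
    using assms unfolding smooth_def by blast+
  then show "(f has_real_derivative deriv f s) (at s)"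
    and "(deriv f has_real_derivative deriv (deriv f) s) (at s)"
    by (auto simp: DERIV_deriv_iff_real_differentiable)
qed

lemma weight_image_torus_points:
  assumes "\<And>s. 0 \<le> \<rho> s"
  shows "weight ` torus_points L \<rho> \<zeta> = profile_weight \<rho> \<zeta> ` {0..L}"
proof -
  have "weight ` torus_points L \<rho> \<zeta> = (\<lambda>(s, \<theta>). profile_weight \<rho> \<zeta> s) ` torus_domain L"
    unfolding torus_points_def image_image
    by (rule image_cong) (auto simp: weight_surface_of_revolution[of \<rho>, OF assms])
  also have "\<dots> = profile_weight \<rho> \<zeta> ` fst ` torus_domain L"
    unfolding image_image by (rule image_cong) auto
  also have "fst ` torus_domain L = {0..L}"
    by (simp add: torus_domain_def)
  finally show ?thesis .
qed

lemma F_functional_le_entropy: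
  "ereal (F_functional D X) \<le> entropy D X"
  unfolding entropy_def by (rule SUP_upper2[of "(0, 1)"]) auto

text \<open>
  The pair of the height \<open>\<zeta>\<close> and its rescaled weighted slope \<open>v = w \<zeta>' / (\<sigma> k)\<close>
  solves \<open>\<zeta>' = a v\<close>, \<open>v' = - b \<zeta>\<close> with \<open>a = \<sigma> k / w\<close> and
  \<open>b = w \<sigma> / (2 k)\<close>, where \<open>k\<close> is the scale of the slope in the phase plane. The
  comparison \<open>a \<le> b\<close> amounts to \<open>2 k\<^sup>2 \<le> w\<^sup>2\<close>, so \<open>k = m / sqrt 2\<close> is
  the largest scale for which \<open>m \<le> w\<close> ensures it; and the integral of \<open>b\<close> is \<open>F / k\<close>.
\<close>

lemma F_functional_shrinking_torus_ge:
  assumes curve: "closed_profile_curve L \<rho> \<zeta>"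
    and shr: "self_shrinker (surface_of_revolution \<rho> \<zeta>)"
    and m: "0 < m" "\<forall>s\<in>{0..L}. m \<le> profile_weight \<rho> \<zeta> s"
  shows "pi * sqrt 2 * m \<le> F_functional (torus_domain L) (surface_of_revolution \<rho> \<zeta>)"
    and "\<exists>s\<in>{0..L}. profile_weight \<rho> \<zeta> s \<noteq> m \<Longrightarrow>
      pi * sqrt 2 * m < F_functional (torus_domain L) (surface_of_revolution \<rho> \<zeta>)"
proof -
  define \<rho>' \<zeta>' where "\<rho>' = deriv \<rho>" and "\<zeta>' = deriv \<zeta>"
  have L: "0 < L" and sm: "smooth \<rho>" "smooth \<zeta>" and pos: "\<And>s. 0 < \<rho> s"
    and per: "\<And>s. \<rho> (s + L) = \<rho> s" "\<And>s. \<zeta> (s + L) = \<zeta> s"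
    and reg: "\<And>s. (\<rho>' s, \<zeta>' s) \<noteq> (0, 0)"
    using curve unfolding closed_profile_curve_def \<rho>'_def \<zeta>'_def by auto
  note d1 = smooth_has_derivs(1)[OF sm(1), folded \<rho>'_def] smooth_has_derivs(1)[OF sm(2), folded \<zeta>'_def]
  note d2 = smooth_has_derivs(2)[OF sm(1), folded \<rho>'_def] smooth_has_derivs(2)[OF sm(2), folded \<zeta>'_def]
  have per': "f' L = f' 0" if "\<And>s. f (s + L) = f s" "\<And>s. (f has_real_derivative f' s) (at s)"
    for f f' :: "real \<Rightarrow> real"
  proof -
    have "((\<lambda>s. f (s + L)) has_real_derivative f' L) (at 0)"
      using that(2)[of L] DERIV_shift[of f "f' L" 0 L] by simp
    then show ?thesis using that DERIV_unique by (metis (no_types, lifting) ext)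
  qed
  have perL: "\<rho> L = \<rho> 0" "\<zeta> L = \<zeta> 0" "\<rho>' L = \<rho>' 0" "\<zeta>' L = \<zeta>' 0"
    using per(1)[of 0] per(2)[of 0] per'[OF per(1) d1(1)] per'[OF per(2) d1(2)] by simp_all
  define w where "w = profile_weight \<rho> \<zeta>"
  define \<sigma> where "\<sigma> = speed \<rho>' \<zeta>'"
  have reg2: "(\<rho>' s)\<^sup>2 + (\<zeta>' s)\<^sup>2 \<noteq> 0" for s
    using reg[of s] by (simp add: sum_power2_eq_zero_iff)
  then have \<sigma>: "0 < \<sigma> s" for s
    unfolding \<sigma>_def speed_def by (simp add: less_le)
  have w: "0 < w s" for s using pos by (simp add: w_def profile_weight_def)
  have c: "continuous_on S \<rho>" "continuous_on S \<zeta>" "continuous_on S \<rho>'" "continuous_on S \<zeta>'" for S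
    using d1 d2 by (meson DERIV_isCont continuous_at_imp_continuous_on)+
  have c\<sigma>: "continuous_on S \<sigma>" and cw: "continuous_on S w" for S
    unfolding \<sigma>_def speed_def w_def profile_weight_def by (intro continuous_intros c; simp)+
  define k where "k = m / sqrt 2"
  have k: "0 < k" and k2: "2 * k\<^sup>2 = m\<^sup>2"
    using m(1) by (auto simp: k_def power_divide)
  define v where "v s = w s * \<zeta>' s / \<sigma> s / k" for s
  define a where "a s = \<sigma> s * k / w s" for s
  define b where "b s = w s * \<sigma> s / (2 * k)" for s
  have F: "F_functional (torus_domain L) (surface_of_revolution \<rho> \<zeta>) = k * integral {0..L} b"
    unfolding F_functional_surface_of_revolution[OF d1 c(3,4) pos] b_def w_def \<sigma>_def
    using k by simp
  have "(v has_real_derivative - (w s * \<sigma> s * \<zeta> s / 2) / k) (at s)" for s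
    unfolding v_def w_def \<sigma>_def
    by (intro DERIV_cdivide weighted_slope_derivative[OF d1 d2 pos reg2 shr])
  then have dv: "(v has_real_derivative - b s * \<zeta> s) (at s)" for s
    by (simp add: b_def field_simps)
  have du: "(\<zeta> has_real_derivative a s * v s) (at s)" for s
    using d1(2)[of s] \<sigma>[of s] w[of s] k by (simp add: a_def v_def)
  have ca: "continuous_on {0..L} a" and cb: "continuous_on {0..L} b"
    unfolding a_def b_def using w k
    by (auto intro!: continuous_intros c\<sigma> cw simp: less_imp_neq[THEN not_sym])
  have a: "0 < a s" for s using \<sigma> w k by (simp add: a_def)
  have b_minus_a: "b s - a s = \<sigma> s * ((w s)\<^sup>2 - m\<^sup>2) / (2 * k * w s)" for s
    unfolding k2[symmetric] a_def b_def using k w[of s]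
    by (simp add: field_simps power2_eq_square)
  have mw: "m\<^sup>2 \<le> (w s)\<^sup>2" if "s \<in> {0..L}" for s
    using m that by (auto simp: w_def intro!: power_mono)
  have ab: "a s \<le> b s" if "s \<in> {0..L}" for s
  proof -
    have "0 \<le> b s - a s"
      unfolding b_minus_a using mw[OF that] \<sigma>[of s] w[of s] k by simp
    then show ?thesis by simp
  qed
  have vper: "v L = v 0"
    by (simp add: v_def w_def profile_weight_def \<sigma>_def speed_def perL)
  obtain t where t: "t \<in> {0..L}" "\<zeta> t \<noteq> 0"
    using closed_curve_leaves_line[OF L perL(1) d1 reg] by blast
  note winding = periodic_system_integral_ge_2pi[OF L du dv ca cb a ab perL(2) vper t]
  have scale: "k * (2 * pi) = pi * sqrt 2 * m"
    by (simp add: k_def field_simps)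
  show "pi * sqrt 2 * m \<le> F_functional (torus_domain L) (surface_of_revolution \<rho> \<zeta>)"
    unfolding F scale[symmetric] using winding(1) k by simp
  assume "\<exists>s\<in>{0..L}. profile_weight \<rho> \<zeta> s \<noteq> m"
  then obtain s where s: "s \<in> {0..L}" "m < w s"
    using m(2) by (force simp: w_def less_le)
  then have "m\<^sup>2 < (w s)\<^sup>2"
    using m(1) by (intro power_strict_mono) auto
  then have "0 < b s - a s"
    unfolding b_minus_a using \<sigma>[of s] w[of s] k by simp
  then have "2 * pi < integral {0..L} b"
    by (intro winding(2)[OF _ s(1)]) auto
  then show "pi * sqrt 2 * m < F_functional (torus_domain L) (surface_of_revolution \<rho> \<zeta>)"
    unfolding F scale[symmetric] using k by (rule mult_strict_left_mono)
qed

theorem theorem5p1: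
  fixes L :: real and \<rho> \<zeta> :: "real \<Rightarrow> real"
  assumes "closed_profile_curve L \<rho> \<zeta>"
    and "self_shrinker (surface_of_revolution \<rho> \<zeta>)"
  shows "(pi * sqrt 2 * (INF x\<in>torus_points L \<rho> \<zeta>. weight x)
            \<le> F_functional (torus_domain L) (surface_of_revolution \<rho> \<zeta>) \<and>
          ereal (pi * sqrt 2 * (INF x\<in>torus_points L \<rho> \<zeta>. weight x))
            \<le> entropy (torus_domain L) (surface_of_revolution \<rho> \<zeta>)) \<and>
         (\<not> weight constant_on torus_points L \<rho> \<zeta> \<longrightarrow>
          pi * sqrt 2 * (INF x\<in>torus_points L \<rho> \<zeta>. weight x)
            < F_functional (torus_domain L) (surface_of_revolution \<rho> \<zeta>) \<and>
          ereal (pi * sqrt 2 * (INF x\<in>torus_points L \<rho> \<zeta>. weight x))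
            < entropy (torus_domain L) (surface_of_revolution \<rho> \<zeta>))"
proof -
  define w where "w = profile_weight \<rho> \<zeta>"
  have L: "0 < L" and sm: "smooth \<rho>" "smooth \<zeta>" and pos: "\<And>s. 0 < \<rho> s"
    using assms(1) unfolding closed_profile_curve_def by auto
  have img: "weight ` torus_points L \<rho> \<zeta> = w ` {0..L}"
    unfolding w_def using weight_image_torus_points pos less_imp_le by metis
  have "continuous_on {0..L} \<rho>" "continuous_on {0..L} \<zeta>"
    using smooth_has_derivs(1)[OF sm(1)] smooth_has_derivs(1)[OF sm(2)]
    by (meson DERIV_isCont continuous_at_imp_continuous_on)+
  then have "continuous_on {0..L} w"
    unfolding w_def profile_weight_def by (intro continuous_intros) auto
  then obtain s0 where s0: "s0 \<in> {0..L}" "\<forall>s\<in>{0..L}. w s0 \<le> w s"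
    using continuous_attains_inf[of "{0..L}" w] L by auto
  have INF: "(INF x\<in>torus_points L \<rho> \<zeta>. weight x) = w s0"
    unfolding img using s0 by (intro cInf_eq_minimum) auto
  have "0 < w s0" using pos by (simp add: w_def profile_weight_def)
  note bound = F_functional_shrinking_torus_ge[OF assms, folded w_def, OF this s0(2)]
  have nonconst: "\<exists>s\<in>{0..L}. w s \<noteq> w s0" if "\<not> weight constant_on torus_points L \<rho> \<zeta>"
  proof (rule ccontr)
    assume "\<not> ?thesis"
    then have "weight ` torus_points L \<rho> \<zeta> \<subseteq> {w s0}"
      unfolding img by auto
    then have "weight constant_on torus_points L \<rho> \<zeta>"
      unfolding constant_on_def by blast
    with that show False by contradiction
  qed
  have ent: "c \<le> F_functional D X \<Longrightarrow> ereal c \<le> entropy D X"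
    "c < F_functional D X \<Longrightarrow> ereal c < entropy D X" for c D X
    using F_functional_le_entropy[of D X]
    by (auto intro: order_trans[of "ereal c" "ereal (F_functional D X)"]
        less_le_trans[of "ereal c" "ereal (F_functional D X)"])
  show ?thesis
    unfolding INF using bound nonconst ent by blast
qed

end
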